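(* Let $X$ be a quasi-2-Segal set, let $n\geq 2$ and $0\le j<n$, and let $h$ be an $n$-simplex of $X$ whose edge $j\to j+1$ is the image of the edge $0\to 1$ of $J$ under some map $a\colon J\to X$. Then there exists an $(n+2)$-simplex $H$ of $X$ such that: - $d_{\{j,j+1,j+2,j+3\}}H$ is the image under $a$ of the 3-simplex $0\to 1\to 0\to 1$ of $J$; - $d_{j+1}H=s_jh$ and $d_{j+2}H=s_{j+1}h$. Furthermore, any number of the faces $d_kH$ with $0\leq k<j$ or $j+3<k\leq n+2$ may be prescribed, as long as they agree with the given data and with each other. That is, let $S\subseteq\{0,\ldots,j-1\}\cup\{j+4,\ldots,n+2\}$ and let $(x_k)_{k\in S}$ be $(n+1)$-simplices of $X$ such that, setting $x_{j+1}=s_jh$ and $x_{j+2}=s_{j+1}h$, one has $d_kx_\ell=d_{\ell-1}x_k$ for all $k<\ell$ in $S\cup\{j+1,j+2\}$, and such that for each $k\in S$ the 3-dimensional face of $x_k$ on the vertices corresponding to the vertices $j,j+1,j+2,j+3$ of $\Delta[n+2]$ (under the identification of $x_k$ with the $k$th face) is the image under $a$ of $0\to1\to0\to1$. Then there exists an $(n+2)$-simplex $H$ of $X$ such that $d_{\{j,j+1,j+2,j+3\}}H$ is the image under $a$ of $0\to1\to0\to1$, $d_{j+1}H=s_jh$, $d_{j+2}H=s_{j+1}h$, and $d_kH=x_k$ for all $k\in S$.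
   Context: $\Delta[n]$ is the standard $n$-simplex and $d_\ell\Delta[n]$ is its face opposite the vertex $\ell$. For $n\geq 3$, a subset $S\subseteq\{0,\ldots,n\}$ is broken if there exist $0\leq i<j<k<\ell\leq n$ such that either $i,k\in S$ and $j,\ell\notin S$, or $i,k\notin S$ and $j,\ell\in S$. For $n\ge 3$ and a broken two-element subset $\{i,j\}\subseteq\{0,\ldots,n\}$, the 2-Segal horn $\Lambda^{i,j}[n]\subseteq\Delta[n]$ is the union of all faces $d_\ell\Delta[n]$ with $\ell\neq i,j$. A simplicial set $X$ is a quasi-2-Segal set if every map $\Lambda^{i,j}[n]\to X$ from a 2-Segal horn extends along the inclusion $\Lambda^{i,j}[n]\hookrightarrow\Delta[n]$ to a map $\Delta[n]\to X$. $J$ is the nerve of the free-living isomorphism, the category with two objects $0,1$ and exactly one morphism in each hom-set. A simplex of $J$ is determined by its sequence of vertices; $0\to1\to0\to1$ denotes the 3-simplex with that vertex sequence. For a simplex $H$ and a set $T$ of its vertices, $d_TH$ denotes the face of $H$ spanned by the vertices in $T$; for a single index $k$, $d_kH$ and $s_kH$ denote the usual face (opposite the $k$th vertex) and degeneracy. *)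

theory Defs
  imports Main "HOL-Library.FuncSet"
begin

text \<open>
  A monotone map \<open>[m] \<rightarrow> [n]\<close> is encoded as the list of its \<open>m + 1\<close> values, so that composition
  \<open>f \<circ> g\<close> becomes \<open>map ((!) f) g\<close>.
\<close>

definition monotone_map :: "nat \<Rightarrow> nat \<Rightarrow> nat list \<Rightarrow> bool" where
  "monotone_map m n f \<longleftrightarrow> length f = Suc m \<and> sorted f \<and> set f \<subseteq> {..n}"

text \<open>
  \<open>act X n f\<close> is the map \<open>X\<^sub>n \<rightarrow> X\<^sub>m\<close> induced by \<open>f : [m] \<rightarrow> [n]\<close>. The index \<open>n\<close> is needed because
  the sets of simplices of different dimensions need not be disjoint; \<open>m\<close> can be read off \<open>f\<close>.
\<close>

record 'a sset =
  cells :: "nat \<Rightarrow> 'a set"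
  act :: "nat \<Rightarrow> nat list \<Rightarrow> 'a \<Rightarrow> 'a"

locale simplicial_set =
  fixes X :: "'a sset"
  assumes act_closed: "\<lbrakk>monotone_map m n f; x \<in> cells X n\<rbrakk> \<Longrightarrow> act X n f x \<in> cells X m"
    and act_id: "x \<in> cells X n \<Longrightarrow> act X n [0..<Suc n] x = x"
    and act_comp: "\<lbrakk>monotone_map l m g; monotone_map m n f; x \<in> cells X n\<rbrakk>
      \<Longrightarrow> act X m g (act X n f x) = act X n (map ((!) f) g) x"

definition simplicial_map :: "'a sset \<Rightarrow> 'b sset \<Rightarrow> (nat \<Rightarrow> 'a \<Rightarrow> 'b) \<Rightarrow> bool" where
  "simplicial_map X Y \<phi> \<longleftrightarrow>
     (\<forall>n. \<forall>x\<in>cells X n. \<phi> n x \<in> cells Y n) \<and>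
     (\<forall>m n f. \<forall>x\<in>cells X n. monotone_map m n f \<longrightarrow> \<phi> m (act X n f x) = act Y n f (\<phi> n x))"

text \<open>\<open>skip k\<close> is the monotone injection of the naturals omitting the value \<open>k\<close>.\<close>

definition skip :: "nat \<Rightarrow> nat \<Rightarrow> nat" where
  "skip k i = (if i < k then i else Suc i)"

text \<open>In the following three definitions \<open>x\<close> is an \<open>n\<close>-simplex of \<open>X\<close>; \<open>face\<close> is meant for \<open>n \<ge> 1\<close>.\<close>

definition face :: "'a sset \<Rightarrow> nat \<Rightarrow> nat \<Rightarrow> 'a \<Rightarrow> 'a" where
  "face X n k x = act X n (map (skip k) [0..<n]) x"

definition degeneracy :: "'a sset \<Rightarrow> nat \<Rightarrow> nat \<Rightarrow> 'a \<Rightarrow> 'a" where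
  "degeneracy X n k x = act X n (map (\<lambda>i. if i \<le> k then i else i - 1) [0..<n + 2]) x"

definition spanned_face :: "'a sset \<Rightarrow> nat \<Rightarrow> nat set \<Rightarrow> 'a \<Rightarrow> 'a" where
  "spanned_face X n T x = act X n (sorted_list_of_set T) x"


definition standard_simplex :: "nat \<Rightarrow> nat list sset" where
  "standard_simplex n =
     \<lparr>cells = (\<lambda>m. {f. monotone_map m n f}), act = (\<lambda>_ g f. map ((!) f) g)\<rparr>"

definition simplex_face :: "nat \<Rightarrow> nat \<Rightarrow> nat list sset" where
  "simplex_face n l =
     (standard_simplex n)\<lparr>cells := (\<lambda>m. {f \<in> cells (standard_simplex n) m. l \<notin> set f})\<rparr>"

definition broken :: "nat \<Rightarrow> nat set \<Rightarrow> bool" where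
  "broken n S \<longleftrightarrow> S \<subseteq> {..n} \<and>
     (\<exists>i j k l. i < j \<and> j < k \<and> k < l \<and> l \<le> n \<and>
        (i \<in> S \<and> k \<in> S \<and> j \<notin> S \<and> l \<notin> S \<or> i \<notin> S \<and> k \<notin> S \<and> j \<in> S \<and> l \<in> S))"

definition horn :: "nat \<Rightarrow> nat \<Rightarrow> nat \<Rightarrow> nat list sset" where
  "horn n i j =
     (standard_simplex n)\<lparr>cells := (\<lambda>m. \<Union>l\<in>{..n} - {i, j}. cells (simplex_face n l) m)\<rparr>"

definition quasi_2_Segal :: "'a sset \<Rightarrow> bool" where
  "quasi_2_Segal X \<longleftrightarrow> simplicial_set X \<and>
     (\<forall>n i j \<phi>. n \<ge> 3 \<longrightarrow> i \<noteq> j \<longrightarrow> broken n {i, j} \<longrightarrow> simplicial_map (horn n i j) X \<phi> \<longrightarrow>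
        (\<exists>\<psi>. simplicial_map (standard_simplex n) X \<psi> \<and>
             (\<forall>m. \<forall>f\<in>cells (horn n i j) m. \<psi> m f = \<phi> m f)))"


record ('o, 'm) cat =
  Ob :: "'o set"
  Hom :: "'o \<Rightarrow> 'o \<Rightarrow> 'm set"
  Ident :: "'o \<Rightarrow> 'm"
  Comp :: "'m \<Rightarrow> 'm \<Rightarrow> 'm"

locale category =
  fixes C :: "('o, 'm) cat"
  assumes Ident_in_Hom: "x \<in> Ob C \<Longrightarrow> Ident C x \<in> Hom C x x"
    and Comp_in_Hom: "\<lbrakk>x \<in> Ob C; y \<in> Ob C; z \<in> Ob C; f \<in> Hom C x y; g \<in> Hom C y z\<rbrakk>
      \<Longrightarrow> Comp C g f \<in> Hom C x z"
    and Comp_Ident_left: "\<lbrakk>x \<in> Ob C; y \<in> Ob C; f \<in> Hom C x y\<rbrakk> \<Longrightarrow> Comp C (Ident C y) f = f"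
    and Comp_Ident_right: "\<lbrakk>x \<in> Ob C; y \<in> Ob C; f \<in> Hom C x y\<rbrakk> \<Longrightarrow> Comp C f (Ident C x) = f"
    and Comp_assoc: "\<lbrakk>w \<in> Ob C; x \<in> Ob C; y \<in> Ob C; z \<in> Ob C;
        f \<in> Hom C w x; g \<in> Hom C x y; h \<in> Hom C y z\<rbrakk>
      \<Longrightarrow> Comp C h (Comp C g f) = Comp C (Comp C h g) f"

text \<open>
  An \<open>n\<close>-simplex of the nerve is a functor from the poset \<open>[n]\<close>, given by its action \<open>F\<close> on
  objects and \<open>G\<close> on arrows, where the pair \<open>(i, j)\<close> stands for the arrow \<open>i \<le> j\<close>. Both are
  \<open>undefined\<close> outside their domains, so that equality of simplices is equality of functors.
\<close>

definition arrows :: "nat \<Rightarrow> (nat \<times> nat) set" where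
  "arrows n = {(i, j). i \<le> j \<and> j \<le> n}"

definition nerve :: "('o, 'm) cat \<Rightarrow> ((nat \<Rightarrow> 'o) \<times> (nat \<times> nat \<Rightarrow> 'm)) sset" where
  "nerve C =
     \<lparr>cells = (\<lambda>n. {(F, G).
         F \<in> {..n} \<rightarrow>\<^sub>E Ob C \<and> G \<in> extensional (arrows n) \<and>
         (\<forall>i j. i \<le> j \<and> j \<le> n \<longrightarrow> G (i, j) \<in> Hom C (F i) (F j)) \<and>
         (\<forall>i\<le>n. G (i, i) = Ident C (F i)) \<and>
         (\<forall>i j k. i \<le> j \<and> j \<le> k \<and> k \<le> n \<longrightarrow> G (i, k) = Comp C (G (j, k)) (G (i, j)))}),
      act = (\<lambda>_ f (F, G).
         (restrict (\<lambda>i. F (f ! i)) {..length f - 1},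
          restrict (\<lambda>(i, j). G (f ! i, f ! j)) (arrows (length f - 1))))\<rparr>"

definition free_iso :: "(nat, nat \<times> nat) cat" where
  "free_iso = \<lparr>Ob = {0, 1}, Hom = (\<lambda>x y. {(x, y)}), Ident = (\<lambda>x. (x, x)),
     Comp = (\<lambda>g f. (fst f, snd g))\<rparr>"

definition J :: "((nat \<Rightarrow> nat) \<times> (nat \<times> nat \<Rightarrow> nat \<times> nat)) sset" where
  "J = nerve free_iso"

text \<open>The simplex of \<open>J\<close> with vertex sequence \<open>v\<close>.\<close>

definition J_simplex :: "nat list \<Rightarrow> (nat \<Rightarrow> nat) \<times> (nat \<times> nat \<Rightarrow> nat \<times> nat)" where
  "J_simplex v =
     (restrict (\<lambda>i. v ! i) {..length v - 1},
      restrict (\<lambda>(i, j). (v ! i, v ! j)) (arrows (length v - 1)))"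


lemma monotone_map_nth_le: "\<lbrakk>monotone_map m n f; i \<le> m\<rbrakk> \<Longrightarrow> f ! i \<le> n"
  unfolding monotone_map_def by (metis atMost_iff le_imp_less_Suc nth_mem subsetD)

lemma monotone_map_nth_mono: "\<lbrakk>monotone_map m n f; i \<le> j; j \<le> m\<rbrakk> \<Longrightarrow> f ! i \<le> f ! j"
  unfolding monotone_map_def by (simp add: sorted_nth_mono)

lemma monotone_map_comp:
  assumes "monotone_map l m g" "monotone_map m n f"
  shows "monotone_map l n (map ((!) f) g)"
proof -
  have "sorted (map ((!) f) g)"
    unfolding sorted_iff_nth_mono
    using assms monotone_map_nth_mono[OF assms(2)] monotone_map_nth_mono[OF assms(1)]
      monotone_map_nth_le[OF assms(1)]
    by (auto simp: monotone_map_def)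
  then show ?thesis
    using assms monotone_map_nth_le[OF assms(2)] by (auto simp: monotone_map_def)
qed

lemma monotone_map_nth_in_set: "\<lbrakk>monotone_map l m g; monotone_map m n f\<rbrakk>
   \<Longrightarrow> set (map ((!) f) g) \<subseteq> set f"
  by (auto simp: monotone_map_def less_Suc_eq_le subset_iff)

lemma simplicial_set_standard_simplex: "simplicial_set (standard_simplex n)"
proof
  fix m k f x
  assume "monotone_map m k f" "x \<in> cells (standard_simplex n) k"
  then show "act (standard_simplex n) k f x \<in> cells (standard_simplex n) m"
    by (simp add: standard_simplex_def monotone_map_comp)
next
  fix x k
  assume "x \<in> cells (standard_simplex n) k"
  then show "act (standard_simplex n) k [0..<Suc k] x = x"
    using map_nth[of x] by (auto simp: standard_simplex_def monotone_map_def simp del: upt_Suc)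
next
  fix l m g k f x
  assume "monotone_map l m g" "monotone_map m k f" "x \<in> cells (standard_simplex n) k"
  then show "act (standard_simplex n) m g (act (standard_simplex n) k f x)
      = act (standard_simplex n) k (map ((!) f) g) x"
    by (auto simp: standard_simplex_def monotone_map_def less_Suc_eq_le subset_iff)
qed

lemma simplicial_set_horn: "simplicial_set (horn n i j)"
proof
  fix m k f x
  assume f: "monotone_map m k f" and x: "x \<in> cells (horn n i j) k"
  then have "monotone_map k n x"
    by (auto simp: horn_def simplex_face_def standard_simplex_def)
  then show "act (horn n i j) k f x \<in> cells (horn n i j) m"
    using f x monotone_map_comp[OF f] monotone_map_nth_in_set[OF f]
    by (fastforce simp: horn_def simplex_face_def standard_simplex_def)
next
  fix x k
  assume "x \<in> cells (horn n i j) k"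
  then show "act (horn n i j) k [0..<Suc k] x = x"
    using simplicial_set.act_id[OF simplicial_set_standard_simplex, of x n k]
    by (auto simp: horn_def simplex_face_def)
next
  fix l m g k f x
  assume "monotone_map l m g" "monotone_map m k f" "x \<in> cells (horn n i j) k"
  then show "act (horn n i j) m g (act (horn n i j) k f x)
      = act (horn n i j) k (map ((!) f) g) x"
    using simplicial_set.act_comp[OF simplicial_set_standard_simplex, of l m g k f x n]
    by (auto simp: horn_def simplex_face_def)
qed

lemma simplicial_set_nerve: "simplicial_set (nerve C)"
proof
  fix m n f x
  assume f: "monotone_map m n f" and x: "x \<in> cells (nerve C) n"
  obtain F G where [simp]: "x = (F, G)" by fastforce
  have "length f - 1 = m" using f by (simp add: monotone_map_def)
  then show "act (nerve C) n f x \<in> cells (nerve C) m"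
    using x monotone_map_nth_le[OF f] monotone_map_nth_mono[OF f]
    by (auto simp: nerve_def arrows_def PiE_iff)
next
  fix x n
  assume x: "x \<in> cells (nerve C) n"
  obtain F G where [simp]: "x = (F, G)" by fastforce
  have "restrict (\<lambda>i. F ([0..<Suc n] ! i)) {..n} = F"
    using x by (intro extensionalityI[where A = "{..n}"])
      (auto simp: nerve_def PiE_iff simp del: upt_Suc)
  moreover have "restrict (\<lambda>(i, j). G ([0..<Suc n] ! i, [0..<Suc n] ! j)) (arrows n) = G"
    using x by (intro extensionalityI[where A = "arrows n"])
      (auto simp: nerve_def arrows_def simp del: upt_Suc)
  ultimately show "act (nerve C) n [0..<Suc n] x = x"
    by (simp add: nerve_def del: upt_Suc)
next
  fix l m g n f x
  assume g: "monotone_map l m g" and f: "monotone_map m n f" and x: "x \<in> cells (nerve C) n"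
  obtain F G where [simp]: "x = (F, G)" by fastforce
  have len: "length f = Suc m" "length g = Suc l"
    using f g by (auto simp: monotone_map_def)
  show "act (nerve C) m g (act (nerve C) n f x) = act (nerve C) n (map ((!) f) g) x"
    using monotone_map_nth_le[OF g] monotone_map_nth_mono[OF g]
    by (auto simp: nerve_def arrows_def len fun_eq_iff restrict_def)
qed

lemma category_free_iso: "category free_iso"
  by unfold_locales (auto simp: free_iso_def)

lemma simplicial_set_J: "simplicial_set J"
  unfolding J_def by (rule simplicial_set_nerve)

lemma cells_J: "cells J n = J_simplex ` {v. length v = Suc n \<and> set v \<subseteq> {0, 1}}"
proof (intro equalityI subsetI)
  fix x assume x: "x \<in> cells J n"
  obtain F G where [simp]: "x = (F, G)" by fastforce
  let ?v = "map F [0..<Suc n]"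
  have "restrict (\<lambda>i. ?v ! i) {..n} = F"
    using x by (intro extensionalityI[where A = "{..n}"])
      (auto simp: J_def nerve_def PiE_iff simp del: upt_Suc)
  moreover have "restrict (\<lambda>(i, j). (?v ! i, ?v ! j)) (arrows n) = G"
    using x by (intro extensionalityI[where A = "arrows n"])
      (auto simp: J_def nerve_def arrows_def free_iso_def simp del: upt_Suc)
  ultimately have "x = J_simplex ?v"
    by (simp add: J_simplex_def del: upt_Suc)
  moreover have "set ?v \<subseteq> {0, 1}"
    using x by (auto simp: J_def nerve_def free_iso_def PiE_def Pi_def less_Suc_eq_le
        simp del: upt_Suc)
  ultimately show "x \<in> J_simplex ` {v. length v = Suc n \<and> set v \<subseteq> {0, 1}}"
    by (intro image_eqI[where x = ?v]) auto
next
  fix x assume "x \<in> J_simplex ` {v. length v = Suc n \<and> set v \<subseteq> {0, 1}}"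
  then obtain v where v: "length v = Suc n" "set v \<subseteq> {0, 1}" and [simp]: "x = J_simplex v"
    by auto
  have "v ! i \<in> {0, 1}" if "i \<le> n" for i
    using v that by (metis le_imp_less_Suc nth_mem subsetD)
  then show "x \<in> cells J n"
    using v by (auto simp: J_def nerve_def J_simplex_def arrows_def free_iso_def PiE_iff)
qed

end

theory Submission
  imports Defs
begin

text \<open>
  The faces \<open>d\<^sub>k H\<close> with \<open>k\<close> outside \<open>{j, \<dots>, j + 3}\<close> pose the same problem for a face of \<open>h\<close>
  that contains the edge \<open>j \<rightarrow> j + 1\<close>. By induction on \<open>n\<close>, starting at \<open>n = 1\<close> with the simplex
  \<open>0 \<rightarrow> 1 \<rightarrow> 0 \<rightarrow> 1\<close> itself, the missing ones among them can be added one at a time, each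
  compatibly with those already chosen. Once \<open>d\<^sub>j H\<close> and \<open>d\<^bsub>j+3\<^esub> H\<close> are the only
  missing faces, the given ones form a horn, and \<open>{j, j + 3}\<close> is broken because \<open>n \<ge> 2\<close> leaves a vertex
  outside \<open>{j, \<dots>, j + 3}\<close>.
\<close>

section \<open>Renumbering vertices when one is omitted\<close>

text \<open>It has two roles: for \<open>i \<noteq> k\<close> it gives the position of vertex
  \<open>i\<close> in the face opposite \<open>k\<close>; as a function of \<open>i\<close> it is
  the degeneracy operator taking the value \<open>k\<close> at both \<open>k\<close> and
  \<open>k + 1\<close>.\<close>

definition unskip :: "nat \<Rightarrow> nat \<Rightarrow> nat" where
  "unskip k i = (if i \<le> k then i else i - 1)"

lemma mono_skip: "mono (skip k)"
  by (auto simp: mono_def skip_def)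

lemma mono_unskip: "mono (unskip k)"
  by (auto simp: mono_def unskip_def)

lemma skip_neq: "skip k i \<noteq> k"
  by (simp add: skip_def)

lemma unskip_skip: "unskip k (skip k i) = i"
  by (simp add: skip_def unskip_def)

lemma skip_unskip: "i \<noteq> k \<Longrightarrow> skip k (unskip k i) = i"
  by (auto simp: skip_def unskip_def)

lemma skip_eq_iff: "skip k i = skip k l \<longleftrightarrow> i = l"
  by (metis unskip_skip)

lemma unskip_neq: "\<lbrakk>k \<noteq> l; i \<noteq> l; i \<noteq> k\<rbrakk> \<Longrightarrow> unskip l i \<noteq> unskip l k"
  by (metis skip_unskip)

text \<open>Both sides renumber \<open>i\<close> after \<open>k\<close> and \<open>l\<close> have
  been omitted, in the two possible orders.\<close>

lemma unskip_unskip: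
  "\<lbrakk>k \<noteq> l; i \<noteq> k; i \<noteq> l\<rbrakk>
    \<Longrightarrow> unskip (unskip l k) (unskip l i) = unskip (unskip k l) (unskip k i)"
  by (simp add: unskip_def) arith

lemma skip_skip:
  "k \<noteq> l \<Longrightarrow> skip l (skip (unskip l k) i) = skip k (skip (unskip k l) i)"
  by (simp add: unskip_def skip_def) arith

lemma unskip_le: "\<lbrakk>i \<le> Suc n; l \<le> Suc n; i \<noteq> l\<rbrakk> \<Longrightarrow> unskip l i \<le> n"
  by (auto simp: unskip_def)

lemma monotone_map_unskip:
  assumes "monotone_map m (Suc n) f" "l \<notin> set f" "l \<le> Suc n"
  shows "monotone_map m n (map (unskip l) f)"
  using assms unskip_le[of _ n l]
  by (fastforce simp: monotone_map_def sorted_map intro: sorted_wrt_mono_rel[of f "(\<le>)"]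
      monoD[OF mono_unskip])

section \<open>Simplicial operators given by functions on the naturals\<close>

text \<open>With functions in place of lists, operators compose as functions, and their equality
  reduces to arithmetic on the vertices up to \<open>m\<close>.\<close>

definition pull :: "'a sset \<Rightarrow> nat \<Rightarrow> nat \<Rightarrow> (nat \<Rightarrow> nat) \<Rightarrow> 'a \<Rightarrow> 'a" where
  "pull X m n f x = act X n (map f [0..<Suc m]) x"

lemma face_eq_pull: "face X (Suc n) k x = pull X n (Suc n) (skip k) x"
  by (simp add: face_def pull_def)

lemma degeneracy_eq_pull: "degeneracy X n k x = pull X (Suc n) n (unskip k) x"
  by (simp add: degeneracy_def pull_def unskip_def[abs_def] del: upt_Suc)

lemma pull_cong: "(\<And>i. i \<le> m \<Longrightarrow> f i = g i) \<Longrightarrow> pull X m n f x = pull X m n g x"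
  unfolding pull_def by (metis (no_types, lifting) atLeastLessThan_iff less_Suc_eq_le map_cong set_upt)

lemma monotone_map_fun:
  assumes "mono f" "\<And>i. i \<le> m \<Longrightarrow> f i \<le> n"
  shows "monotone_map m n (map f [0..<Suc m])"
  using assms
  by (auto simp: monotone_map_def sorted_iff_nth_mono less_Suc_eq_le mono_def simp del: upt_Suc)

context simplicial_set
begin

lemma pull_closed:
  "\<lbrakk>mono f; \<And>i. i \<le> m \<Longrightarrow> f i \<le> n; x \<in> cells X n\<rbrakk> \<Longrightarrow> pull X m n f x \<in> cells X m"
  unfolding pull_def by (intro act_closed[of m n] monotone_map_fun)

lemma face_closed: "\<lbrakk>k \<le> Suc n; x \<in> cells X (Suc n)\<rbrakk> \<Longrightarrow> face X (Suc n) k x \<in> cells X n"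
  unfolding face_eq_pull by (rule pull_closed) (auto simp: mono_skip skip_def)

lemma pull_id: "\<lbrakk>x \<in> cells X n; \<And>i. i \<le> n \<Longrightarrow> f i = i\<rbrakk> \<Longrightarrow> pull X n n f x = x"
  using pull_cong[of n f id X n x] act_id[of x n] by (simp add: pull_def del: upt_Suc)

lemma pull_pull:
  assumes "mono f" "\<And>i. i \<le> m \<Longrightarrow> f i \<le> n" "mono g" "\<And>i. i \<le> l \<Longrightarrow> g i \<le> m"
    and "x \<in> cells X n"
  shows "pull X l m g (pull X m n f x) = pull X l n (\<lambda>i. f (g i)) x"
proof -
  have *: "map ((!) (map f [0..<Suc m])) (map g [0..<Suc l]) = map (\<lambda>i. f (g i)) [0..<Suc l]"
    using assms(4) by (auto simp: less_Suc_eq_le simp del: upt_Suc)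
  show ?thesis
    unfolding pull_def
    using act_comp[OF monotone_map_fun[OF assms(3,4)] monotone_map_fun[OF assms(1,2)] assms(5)]
    by (simp only: *)
qed

text \<open>Both sides restrict \<open>x\<close> to the face omitting \<open>k\<close> and
  \<open>l\<close>.\<close>

lemma face_face:
  assumes "k \<noteq> l" "k \<le> Suc (Suc n)" "l \<le> Suc (Suc n)" "x \<in> cells X (Suc (Suc n))"
  shows "face X (Suc n) (unskip l k) (face X (Suc (Suc n)) l x)
    = face X (Suc n) (unskip k l) (face X (Suc (Suc n)) k x)"
  unfolding face_eq_pull
  using assms
  by (subst (1 2) pull_pull) (auto simp: mono_skip skip_def unskip_def intro!: pull_cong)

end

section \<open>Compatible families and horns\<close>

text \<open>
  A family of \<open>n\<close>-simplices that agree like the faces \<open>d\<^sub>k\<close>, \<open>k \<in> A\<close>, of an \<open>(n + 1)\<close>-simplex.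
  Writing the position of vertex \<open>k\<close> in the face opposite \<open>l\<close> as \<open>unskip l k\<close> makes the
  usual condition for \<open>k < l\<close> symmetric in \<open>k\<close> and \<open>l\<close>.
\<close>

definition compatible :: "'a sset \<Rightarrow> nat \<Rightarrow> nat set \<Rightarrow> (nat \<Rightarrow> 'a) \<Rightarrow> bool" where
  "compatible X n A x \<longleftrightarrow> (\<forall>k\<in>A. x k \<in> cells X n) \<and>
     (\<forall>k\<in>A. \<forall>l\<in>A. k \<noteq> l \<longrightarrow> face X n (unskip l k) (x l) = face X n (unskip k l) (x k))"

text \<open>A simplex \<open>f\<close> lying in the faces opposite \<open>k\<close> and
  \<open>l\<close> factors through their intersection, where \<open>x k\<close> and
  \<open>x l\<close> agree. This makes the map out of a horn well defined.\<close>

lemma (in simplicial_set) compatible_act_eq: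
  assumes x: "compatible X (Suc n) A x" and A: "A \<subseteq> {..Suc (Suc n)}"
    and f: "monotone_map m (Suc (Suc n)) f"
    and k: "k \<in> A" "k \<notin> set f" and l: "l \<in> A" "l \<notin> set f"
  shows "act X (Suc n) (map (unskip k) f) (x k) = act X (Suc n) (map (unskip l) f) (x l)"
proof (cases "k = l")
  case False
  \<comment> \<open>The value at \<open>f\<close> is read off from the face of \<open>x l\<close>
    that omits \<open>k\<close> as well. The claim is used for both orders of the pair.\<close>
  have *: "act X (Suc n) (map (unskip l) f) (x l)
      = act X n (map (unskip (unskip l k)) (map (unskip l) f)) (face X (Suc n) (unskip l k) (x l))"
    if "k \<noteq> l" "k \<in> A" "k \<notin> set f" "l \<in> A" "l \<notin> set f" for k l
  proof -
    let ?p = "unskip l k"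
    let ?f = "map (unskip l) f"
    let ?g = "map (unskip ?p) ?f"
    have f': "monotone_map m (Suc n) ?f"
      using monotone_map_unskip[OF f] that A by blast
    have p: "?p \<le> Suc n"
      using that A by (intro unskip_le) auto
    have ne: "i \<in> set ?f \<Longrightarrow> i \<noteq> ?p" for i
      using that by (auto dest: unskip_neq)
    then have "monotone_map m n ?g"
      using p by (intro monotone_map_unskip[OF f']) auto
    moreover have "monotone_map n (Suc n) (map (skip ?p) [0..<Suc n])"
      by (intro monotone_map_fun mono_skip) (auto simp: skip_def)
    moreover have "map ((!) (map (skip ?p) [0..<Suc n])) ?g = ?f"
    proof -
      have "i \<le> n" if "i \<in> set ?g" for i
        using \<open>monotone_map m n ?g\<close> that unfolding monotone_map_def by auto
      then have "map ((!) (map (skip ?p) [0..<Suc n])) ?g = map (skip ?p) ?g"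
        by (auto simp: less_Suc_eq_le simp del: upt_Suc)
      also have "\<dots> = map id ?f"
        unfolding map_map o_def[of "skip ?p"]
        using ne skip_unskip by (auto intro!: map_cong)
      finally show ?thesis by simp
    qed
    moreover have "x l \<in> cells X (Suc n)"
      using x that by (simp add: compatible_def)
    ultimately show ?thesis
      unfolding face_def using act_comp by metis
  qed
  have "unskip (unskip l k) (unskip l i) = unskip (unskip k l) (unskip k i)" if "i \<in> set f" for i
    using False k l that by (intro unskip_unskip) auto
  then have "map (unskip (unskip l k)) (map (unskip l) f)
      = map (unskip (unskip k l)) (map (unskip k) f)"
    by simp
  moreover have "face X (Suc n) (unskip l k) (x l) = face X (Suc n) (unskip k l) (x k)"
    using x False k l by (simp add: compatible_def)
  ultimately show ?thesis
    using *[of k l] *[of l k] False k l by (simp del: map_map)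
qed simp

text \<open>A compatible family defines a map out of the horn, as each simplex of the horn lies in
  one of the faces. By the Yoneda lemma its extension amounts to a simplex \<open>H\<close>, the
  value at the identity of \<open>[n + 2]\<close>.\<close>

lemma horn_fill:
  assumes X: "quasi_2_Segal X" and n: "n \<ge> 1"
    and ij: "broken (Suc (Suc n)) {i, j}" "i \<noteq> j"
    and x: "compatible X (Suc n) ({..Suc (Suc n)} - {i, j}) x"
  shows "\<exists>H\<in>cells X (Suc (Suc n)). \<forall>k\<in>{..Suc (Suc n)} - {i, j}. face X (Suc (Suc n)) k H = x k"
proof -
  let ?N = "Suc (Suc n)"
  let ?A = "{..?N} - {i, j}"
  interpret simplicial_set X
    using X by (simp add: quasi_2_Segal_def)
  \<comment> \<open>Any available face containing \<open>f\<close> may serve: by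
    \<open>compatible_act_eq\<close> the value does not depend on the choice of
    \<open>l\<close>.\<close>
  define \<phi> where "\<phi> = (\<lambda>(m::nat) f. let l = SOME l. l \<in> ?A \<and> l \<notin> set f
    in act X (Suc n) (map (unskip l) f) (x l))"
  have horn: "f \<in> cells (horn ?N i j) m \<longleftrightarrow> monotone_map m ?N f \<and> (\<exists>l. l \<in> ?A \<and> l \<notin> set f)" for m f
    by (auto simp: horn_def simplex_face_def standard_simplex_def)
  have act_horn: "act (horn ?N i j) m g f = map ((!) f) g" for m g f
    by (simp add: horn_def standard_simplex_def)
  have \<phi>: "\<phi> m f = act X (Suc n) (map (unskip l) f) (x l)"
    if "monotone_map m ?N f" "l \<in> ?A" "l \<notin> set f" for m f l
    unfolding \<phi>_def Let_def
    using someI_ex[of "\<lambda>l. l \<in> ?A \<and> l \<notin> set f"] that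
    by (intro compatible_act_eq[OF x, of m]) auto
  have "simplicial_map (horn ?N i j) X \<phi>"
    unfolding simplicial_map_def
  proof (intro conjI allI ballI impI)
    fix m f assume "f \<in> cells (horn ?N i j) m"
    then obtain l where l: "monotone_map m ?N f" "l \<in> ?A" "l \<notin> set f"
      by (auto simp: horn)
    then have "monotone_map m (Suc n) (map (unskip l) f)"
      by (intro monotone_map_unskip) auto
    then show "\<phi> m f \<in> cells X m"
      using \<phi>[OF l] l x act_closed by (simp add: compatible_def)
  next
    fix k m g f assume "f \<in> cells (horn ?N i j) m" and g: "monotone_map k m g"
    then obtain l where l: "monotone_map m ?N f" "l \<in> ?A" "l \<notin> set f"
      by (auto simp: horn)
    let ?g = "map ((!) f) g"
    have "monotone_map m (Suc n) (map (unskip l) f)"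
      using l by (intro monotone_map_unskip) auto
    moreover have "x l \<in> cells X (Suc n)"
      using l x by (simp add: compatible_def)
    ultimately have "act X m g (\<phi> m f) = act X (Suc n) (map ((!) (map (unskip l) f)) g) (x l)"
      unfolding \<phi>[OF l] by (rule act_comp[OF g])
    also have "map ((!) (map (unskip l) f)) g = map (unskip l) ?g"
      using g l by (auto simp: monotone_map_def less_Suc_eq_le subset_iff)
    also have "act X (Suc n) (map (unskip l) ?g) (x l) = \<phi> k ?g"
      using l monotone_map_comp[OF g l(1)] monotone_map_nth_in_set[OF g l(1)]
      by (intro \<phi>[symmetric]) auto
    finally show "\<phi> k (act (horn ?N i j) m g f) = act X m g (\<phi> m f)"
      by (simp add: act_horn)
  qed
  then obtain \<psi> where \<psi>: "simplicial_map (standard_simplex ?N) X \<psi>"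
    and ext: "\<And>m f. f \<in> cells (horn ?N i j) m \<Longrightarrow> \<psi> m f = \<phi> m f"
    using X ij n unfolding quasi_2_Segal_def by (metis Suc_le_mono One_nat_def numeral_3_eq_3)
  let ?id = "[0..<Suc ?N]"
  have id: "?id \<in> cells (standard_simplex ?N) ?N"
    by (auto simp: standard_simplex_def monotone_map_def simp del: upt_Suc)
  \<comment> \<open>The face of the identity opposite \<open>k\<close> lies in the horn, so its
    value is already prescribed.\<close>
  have "face X ?N k (\<psi> ?N ?id) = x k" if k: "k \<in> ?A" for k
  proof -
    let ?d = "map (skip k) [0..<?N]"
    have d: "monotone_map (Suc n) ?N ?d"
      by (intro monotone_map_fun mono_skip) (auto simp: skip_def)
    have k_d: "k \<notin> set ?d"
      by (auto simp: skip_def split: if_splits simp del: upt_Suc)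
    have "face X ?N k (\<psi> ?N ?id) = \<psi> (Suc n) (act (standard_simplex ?N) ?N ?d ?id)"
      using \<psi> id d unfolding simplicial_map_def face_def by metis
    also have "act (standard_simplex ?N) ?N ?d ?id = ?d"
      using monotone_map_nth_le[OF d]
      by (auto simp: standard_simplex_def skip_def simp del: upt_Suc)
    also have "\<psi> (Suc n) ?d = \<phi> (Suc n) ?d"
      using d k k_d by (intro ext) (unfold horn, blast)
    also have "\<dots> = act X (Suc n) (map (unskip k) ?d) (x k)"
      using d k k_d by (intro \<phi>)
    also have "map (unskip k) ?d = [0..<?N]"
      by (simp add: o_def unskip_skip map_idI del: upt_Suc)
    also have "act X (Suc n) [0..<?N] (x k) = x k"
      using k x by (intro act_id) (simp add: compatible_def)
    finally show ?thesis .
  qed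
  moreover have "\<psi> ?N ?id \<in> cells X ?N"
    using \<psi> id by (simp add: simplicial_map_def)
  ultimately show ?thesis by blast
qed

section \<open>The filling problem induced on a missing face\<close>

text \<open>
  The faces opposite \<open>j\<close> and \<open>j + 3\<close> are left to a horn filler. The condition on \<open>w\<close> is
  meaningless for \<open>k = j + 1\<close> and \<open>k = j + 2\<close>, whose faces lack a vertex of \<open>w\<close>.
\<close>

definition partial_filler ::
    "'a sset \<Rightarrow> 'a \<Rightarrow> nat \<Rightarrow> nat \<Rightarrow> 'a \<Rightarrow> nat set \<Rightarrow> (nat \<Rightarrow> 'a) \<Rightarrow> bool" where
  "partial_filler X w n j h S x \<longleftrightarrow>
     {j + 1, j + 2} \<subseteq> S \<and> S \<subseteq> {..n + 2} - {j, j + 3} \<and> compatible X (Suc n) S x \<and>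
     x (j + 1) = degeneracy X n j h \<and> x (j + 2) = degeneracy X n (j + 1) h \<and>
     (\<forall>k\<in>S - {j + 1, j + 2}. pull X 3 (Suc n) (\<lambda>i. unskip k (j + i)) (x k) = w)"

definition fills :: "'a sset \<Rightarrow> 'a \<Rightarrow> nat \<Rightarrow> nat \<Rightarrow> nat set \<Rightarrow> (nat \<Rightarrow> 'a) \<Rightarrow> 'a \<Rightarrow> bool" where
  "fills X w n j S x H \<longleftrightarrow> H \<in> cells X (Suc (Suc n)) \<and> pull X 3 (Suc (Suc n)) ((+) j) H = w \<and>
     (\<forall>k\<in>S. face X (Suc (Suc n)) k H = x k)"

context simplicial_set
begin

text \<open>Here \<open>k\<close> numbers the vertices of an \<open>(n + 3)\<close>-simplex whose
  face opposite \<open>i + 1\<close> is the degeneracy of \<open>h\<close>. A vertex above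
  \<open>i + 2\<close> moves down once in passing to that face and once more in passing to
  \<open>h\<close>, hence \<open>k - 2\<close>.\<close>

lemma face_degeneracy:
  assumes "h \<in> cells X (Suc n)" "k \<le> n + 3" "i \<le> Suc n" "k < i \<or> i + 2 < k"
  shows "face X (Suc (Suc n)) (unskip (i + 1) k) (degeneracy X (Suc n) i h)
    = degeneracy X n (unskip k i) (face X (Suc n) (if k < i then k else k - 2) h)"
  unfolding face_eq_pull degeneracy_eq_pull
  using assms
  by (subst (1 2) pull_pull) (auto simp: mono_skip mono_unskip skip_def unskip_def intro!: pull_cong)

text \<open>These are the faces that a simplex opposite \<open>k\<close> must share with the given
  ones. Two of them agree because the given simplices already agree on their common face, from which
  \<open>k\<close> is then omitted too.\<close>

lemma compatible_link:
  assumes x: "compatible X (Suc (Suc n)) S x" and S: "S \<subseteq> {..n + 3}"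
    and k: "k \<notin> S" "k \<le> n + 3"
  shows "compatible X (Suc n) {i. skip k i \<in> S}
    (\<lambda>i. face X (Suc (Suc n)) (unskip (skip k i) k) (x (skip k i)))"
  unfolding compatible_def
proof (intro conjI ballI impI)
  fix i assume "i \<in> {i. skip k i \<in> S}"
  then have i: "skip k i \<in> S" by simp
  with S have "skip k i \<le> n + 3" by auto
  then have "unskip (skip k i) k \<le> Suc (Suc n)"
    using k skip_neq[of k i] by (intro unskip_le) auto
  then show "face X (Suc (Suc n)) (unskip (skip k i) k) (x (skip k i)) \<in> cells X (Suc n)"
    using i x by (intro face_closed) (auto simp: compatible_def)
next
  fix i i' assume "i \<in> {i. skip k i \<in> S}" "i' \<in> {i. skip k i \<in> S}" and ne: "i \<noteq> i'"
  moreover define l l' where "l = skip k i" and "l' = skip k i'"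
  ultimately have l: "l \<in> S" "l' \<in> S" "l \<noteq> l'" "l \<noteq> k" "l' \<noteq> k"
    and i: "i = unskip k l" "i' = unskip k l'"
    by (auto simp: skip_eq_iff skip_neq unskip_skip)
  \<comment> \<open>Inside the single simplex \<open>x l'\<close>, the vertices \<open>k\<close> and
    \<open>l\<close> may be omitted in either order.\<close>
  have *: "face X (Suc n) (unskip (unskip k l') (unskip k l)) (face X (Suc (Suc n)) (unskip l' k) (x l'))
    = face X (Suc n) (unskip (unskip l' l) (unskip l' k)) (face X (Suc (Suc n)) (unskip l' l) (x l'))"
    if "l \<in> S" "l' \<in> S" "l \<noteq> l'" "l \<noteq> k" "l' \<noteq> k" for l l'
  proof -
    have "l \<le> n + 3" "l' \<le> n + 3" using that S by auto
    moreover have "x l' \<in> cells X (Suc (Suc n))"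
      using that x by (simp add: compatible_def)
    moreover have "unskip (unskip k l') (unskip k l) = unskip (unskip l' k) (unskip l' l)"
      using that by (intro unskip_unskip) auto
    moreover have "unskip l' l \<noteq> unskip l' k"
      using that by (intro unskip_neq) auto
    ultimately show ?thesis
      using k that by (simp only:) (intro face_face unskip_le; auto)
  qed
  have "face X (Suc n) (unskip i' i) (face X (Suc (Suc n)) (unskip l' k) (x l'))
    = face X (Suc n) (unskip (unskip l' l) (unskip l' k)) (face X (Suc (Suc n)) (unskip l' l) (x l'))"
    unfolding i using l by (intro *)
  also have "face X (Suc (Suc n)) (unskip l' l) (x l') = face X (Suc (Suc n)) (unskip l l') (x l)"
    using l x by (auto simp: compatible_def)
  also have "unskip (unskip l' l) (unskip l' k) = unskip (unskip l l') (unskip l k)"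
    using l by (intro unskip_unskip) auto
  also have "face X (Suc n) (unskip (unskip l l') (unskip l k)) (face X (Suc (Suc n)) (unskip l l') (x l))
    = face X (Suc n) (unskip i i') (face X (Suc (Suc n)) (unskip l k) (x l))"
    unfolding i using l by (intro *[symmetric]) auto
  finally show "face X (Suc n) (unskip i' i) (face X (Suc (Suc n)) (unskip (skip k i') k) (x (skip k i')))
    = face X (Suc n) (unskip i i') (face X (Suc (Suc n)) (unskip (skip k i) k) (x (skip k i)))"
    by (simp add: l_def l'_def)
qed

text \<open>This drives the induction on dimension. Since \<open>k\<close> avoids
  \<open>j, ..., j + 3\<close>, omitting it keeps these vertices consecutive, and the two prescribed
  degeneracies of \<open>h\<close> restrict to degeneracies of one face of \<open>h\<close>.\<close>

lemma partial_filler_link: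
  assumes pf: "partial_filler X w (Suc n) j h S x" and h: "h \<in> cells X (Suc n)" and j: "j < Suc n"
    and k: "k \<notin> S" "k \<le> n + 3" "k < j \<or> j + 3 < k"
  shows "partial_filler X w n (unskip k j) (face X (Suc n) (if k < j then k else k - 2) h)
    {i. skip k i \<in> S} (\<lambda>i. face X (Suc (Suc n)) (unskip (skip k i) k) (x (skip k i)))"
proof -
  let ?j = "unskip k j"
  let ?x = "\<lambda>i. face X (Suc (Suc n)) (unskip (skip k i) k) (x (skip k i))"
  have S: "S \<subseteq> {..n + 3} - {j, j + 3}" "j + 1 \<in> S" "j + 2 \<in> S"
    and x: "compatible X (Suc (Suc n)) S x"
    and w: "\<And>k. k \<in> S - {j + 1, j + 2} \<Longrightarrow> pull X 3 (Suc (Suc n)) (\<lambda>i. unskip k (j + i)) (x k) = w"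
    using pf by (auto simp: partial_filler_def)
  \<comment> \<open>The four vertices shift together, as \<open>k\<close> lies outside their
    range.\<close>
  have skip: "skip k (?j + i) = j + i" if "i \<le> 3" for i
    using k that by (auto simp: skip_def unskip_def)
  have "{?j + 1, ?j + 2} \<subseteq> {i. skip k i \<in> S}"
    using S skip[of 1] skip[of 2] by simp
  moreover have "{i. skip k i \<in> S} \<subseteq> {..n + 2} - {?j, ?j + 3}"
  proof
    fix i assume "i \<in> {i. skip k i \<in> S}"
    then have "skip k i \<le> n + 3" "skip k i \<noteq> j" "skip k i \<noteq> j + 3" using S by auto
    then show "i \<in> {..n + 2} - {?j, ?j + 3}"
      using skip[of 0] skip[of 3] k by (auto simp: skip_def split: if_splits)
  qed
  moreover have "compatible X (Suc n) {i. skip k i \<in> S} ?x"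
    using x S k by (intro compatible_link) auto
  moreover have "?x (?j + 1) = degeneracy X n ?j (face X (Suc n) (if k < j then k else k - 2) h)"
    using pf skip[of 1] face_degeneracy[OF h, of k j] k j by (auto simp: partial_filler_def)
  moreover have "?x (?j + 2) = degeneracy X n (?j + 1) (face X (Suc n) (if k < j then k else k - 2) h)"
  proof -
    \<comment> \<open>At \<open>j + 1\<close>, \<open>face_degeneracy\<close> distinguishes cases at
      \<open>j + 1\<close> instead of \<open>j\<close>; these coincide because
      \<open>k \<noteq> j\<close>.\<close>
    have "unskip k (j + 1) = ?j + 1" "(if k < j + 1 then k else k - 2) = (if k < j then k else k - 2)"
      using k by (auto simp: unskip_def)
    then show ?thesis
      using pf skip[of 2] face_degeneracy[OF h, of k "j + 1"] k j by (auto simp: partial_filler_def)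
  qed
  moreover have "pull X 3 (Suc n) (\<lambda>i. unskip l (?j + i)) (?x l) = w"
    if l: "l \<in> {i. skip k i \<in> S} - {?j + 1, ?j + 2}" for l
  proof -
    let ?l = "skip k l"
    have l': "?l \<in> S - {j + 1, j + 2}"
      using l skip[of 1] skip[of 2] skip_eq_iff[of k l "?j + 1"] skip_eq_iff[of k l "?j + 2"]
      by auto
    then have "x ?l \<in> cells X (Suc (Suc n))" using x by (simp add: compatible_def)
    moreover have le: "?l \<le> n + 3" "?l \<noteq> j" "?l \<noteq> j + 3" "?l \<noteq> j + 1" "?l \<noteq> j + 2"
      using S l' by auto
    moreover have "mono (\<lambda>i. unskip l (?j + i))"
      by (auto simp: mono_def unskip_def)
    \<comment> \<open>As \<open>k\<close> is none of the four vertices, omitting it from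
      \<open>x ?l\<close> leaves the 3-simplex on them intact.\<close>
    ultimately have "pull X 3 (Suc n) (\<lambda>i. unskip l (?j + i)) (?x l)
      = pull X 3 (Suc (Suc n)) (\<lambda>i. skip (unskip ?l k) (unskip l (?j + i))) (x ?l)"
      unfolding face_eq_pull using k j
      by (intro pull_pull mono_skip) (auto simp: skip_def unskip_def split: if_splits)
    also have "\<dots> = pull X 3 (Suc (Suc n)) (\<lambda>i. unskip ?l (j + i)) (x ?l)"
      using le k by (intro pull_cong) (auto simp: skip_def unskip_def split: if_splits)
    also have "\<dots> = w" using w[OF l'] .
    finally show ?thesis .
  qed
  ultimately show ?thesis
    using x unfolding partial_filler_def by blast
qed

text \<open>The induced problem on face \<open>k\<close> prescribes exactly the faces that
  \<open>y\<close> must share with the simplices already chosen, so solving it gives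
  compatibility.\<close>

lemma partial_filler_insert:
  assumes pf: "partial_filler X w (Suc n) j h S x"
    and k: "k \<notin> S" "k \<le> n + 3" "k < j \<or> j + 3 < k"
    and y: "fills X w n (unskip k j) {i. skip k i \<in> S}
      (\<lambda>i. face X (Suc (Suc n)) (unskip (skip k i) k) (x (skip k i))) y"
  shows "partial_filler X w (Suc n) j h (insert k S) (x(k := y))"
proof -
  have *: "face X (Suc (Suc n)) (unskip k l) y = face X (Suc (Suc n)) (unskip l k) (x l)"
    if "l \<in> S" for l
  proof -
    have "skip k (unskip k l) = l"
      using that k by (intro skip_unskip) auto
    then show ?thesis
      using y that by (auto simp: fills_def)
  qed
  have "pull X 3 (Suc (Suc n)) (\<lambda>i. unskip k (j + i)) y
      = pull X 3 (Suc (Suc n)) ((+) (unskip k j)) y"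
    using k by (intro pull_cong) (auto simp: unskip_def)
  also have "\<dots> = w" using y by (simp add: fills_def)
  finally show ?thesis
    using pf k y * unfolding partial_filler_def compatible_def
    by (auto simp: fills_def)
qed

end

section \<open>The induction on dimension\<close>

text \<open>\<open>w\<close> and \<open>e\<close> stand for the images of
  \<open>0 -> 1 -> 0 -> 1\<close> and \<open>0 -> 1\<close>, with the face identities inherited from
  \<open>J\<close>. For \<open>n = 1\<close> the pair \<open>{0, 3}\<close> is not broken, but there
  \<open>w\<close> itself is the filler. Passing to a face changes \<open>j\<close>,
  \<open>h\<close>, \<open>S\<close> and \<open>x\<close>, so all of them vary in the
  induction.\<close>

lemma partial_filler_fill:
  assumes X: "quasi_2_Segal X" and w: "w \<in> cells X 3" "e \<in> cells X 1"
    and w_faces: "face X 3 1 w = degeneracy X 1 0 e" "face X 3 2 w = degeneracy X 1 1 e"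
    and "1 \<le> n" "j < n" "h \<in> cells X n" "pull X 1 n ((+) j) h = e" "partial_filler X w n j h S x"
  shows "\<exists>H. fills X w n j S x H"
  using assms(6-)
proof (induction n arbitrary: j h S x rule: nat_induct_at_least)
  case base
  interpret simplicial_set X
    using X by (simp add: quasi_2_Segal_def)
  have j: "j = 0" using base by simp
  have "pull X 1 1 ((+) 0) h = h"
    using base by (intro pull_id) auto
  then have h: "h = e"
    using base(3) unfolding j by (rule trans[OF sym])
  have "{..1 + 2} - {0, 0 + 3} = {1, 2 :: nat}"
    by auto
  then have "S = {1, 2}"
    using base(4) unfolding j partial_filler_def by auto
  moreover have "pull X 3 3 ((+) 0) w = w"
    using w by (intro pull_id) auto
  ultimately have "fills X w 1 j S x w"
    using base w w_faces unfolding fills_def partial_filler_def j h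
    by (simp add: numeral_3_eq_3 numeral_2_eq_2)
  then show ?case ..
next
  case (Suc n)
  interpret simplicial_set X
    using X by (simp add: quasi_2_Segal_def)
  note IH = Suc.IH
  \<comment> \<open>The family is extended to all faces except those opposite \<open>j\<close> and
    \<open>j + 3\<close>, by an inner induction on the number still missing.\<close>
  have "\<exists>x'. (\<forall>k\<in>S. x' k = x k) \<and>
      partial_filler X w (Suc n) j h ({..n + 3} - {j, j + 3}) x'"
    using Suc.prems
  proof (induction "card ({..n + 3} - {j, j + 3} - S)" arbitrary: S x)
    case 0
    then have "S = {..n + 3} - {j, j + 3}"
      by (auto simp: partial_filler_def)
    then show ?case using 0 by blast
  next
    case (Suc c)
    note j = \<open>j < Suc n\<close> and h = \<open>h \<in> cells X (Suc n)\<close> and pf = Suc.prems(4)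
    have "{..n + 3} - {j, j + 3} - S \<noteq> {}"
      using Suc.hyps(2) by (metis card.empty nat.distinct(1))
    then obtain k where k: "k \<in> {..n + 3} - {j, j + 3} - S" by blast
    moreover have "{j + 1, j + 2} \<subseteq> S"
      using pf by (simp add: partial_filler_def)
    moreover from this k have "k \<noteq> j + 1" "k \<noteq> j + 2" by auto
    ultimately have k': "k \<notin> S" "k \<le> n + 3" "k < j \<or> j + 3 < k" by auto
    \<comment> \<open>The vertex of \<open>h\<close> corresponding to \<open>k\<close>: vertices
      above \<open>j + 3\<close> sit two places lower in \<open>h\<close>.\<close>
    let ?q = "if k < j then k else k - 2"
    have q: "?q \<le> Suc n" using k' j by auto
    have j': "unskip k j < n" using k' j by (auto simp: unskip_def)
    \<comment> \<open>\<open>?q\<close> is neither \<open>j\<close> nor \<open>j + 1\<close>, so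
      this face of \<open>h\<close> still contains the edge \<open>e\<close>.\<close>
    have e': "pull X 1 n ((+) (unskip k j)) (face X (Suc n) ?q h) = e"
      unfolding \<open>pull X 1 (Suc n) ((+) j) h = e\<close>[symmetric]
      unfolding face_eq_pull using k' j h
      by (subst pull_pull) (auto simp: mono_skip mono_def skip_def unskip_def intro!: pull_cong)
    then obtain y where "fills X w n (unskip k j) {i. skip k i \<in> S}
      (\<lambda>i. face X (Suc (Suc n)) (unskip (skip k i) k) (x (skip k i))) y"
      using IH[OF j' face_closed[OF q h] e' partial_filler_link[OF pf h j k']] by blast
    then have "partial_filler X w (Suc n) j h (insert k S) (x(k := y))"
      by (rule partial_filler_insert[OF pf k'])
    moreover have "c = card ({..n + 3} - {j, j + 3} - insert k S)"
      using Suc.hyps(2) k by (simp add: Diff_insert[of _ k S])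
    ultimately obtain x' where "\<forall>i\<in>insert k S. x' i = (x(k := y)) i"
      "partial_filler X w (Suc n) j h ({..n + 3} - {j, j + 3}) x'"
      using Suc.hyps(1) Suc.prems(1-3) by blast
    then show ?case using k' by (intro exI[of _ x']) auto
  qed
  then obtain x' where x': "\<forall>k\<in>S. x' k = x k"
    and pf: "partial_filler X w (Suc n) j h ({..n + 3} - {j, j + 3}) x'" by blast
  \<comment> \<open>A vertex outside \<open>{j, ..., j + 3}\<close>; \<open>4\<close> is available
    because \<open>n \<ge> 1\<close>. The face opposite it contains all four vertices, so that
    \<open>w\<close> can be read off from it below.\<close>
  define k where "k = (if j = 0 then 4 else 0 :: nat)"
  have k: "k \<in> {..n + 3} - {j, j + 3}" "k < j \<or> j + 3 < k"
    using Suc.hyps by (auto simp: k_def)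
  \<comment> \<open>The alternating quadruple is \<open>0 < 1 < 3 < 4\<close> for
    \<open>j = 0\<close>, with the pair in first and third place, and
    \<open>0 < j < j + 1 < j + 3\<close> otherwise, with the pair in second and fourth
    place.\<close>
  have "broken (n + 3) {j, j + 3}"
  proof (cases "j = 0")
    case True
    then show ?thesis
      unfolding broken_def using Suc.hyps
      by (intro conjI exI[of _ 0] exI[of _ 1] exI[of _ 3] exI[of _ 4]) auto
  next
    case False
    then show ?thesis
      unfolding broken_def using \<open>j < Suc n\<close>
      by (intro conjI exI[of _ 0] exI[of _ j] exI[of _ "j + 1"] exI[of _ "j + 3"]) auto
  qed
  then obtain H where H: "H \<in> cells X (Suc (Suc (Suc n)))"
    and faces: "\<And>k. k \<in> {..n + 3} - {j, j + 3} \<Longrightarrow> face X (Suc (Suc (Suc n))) k H = x' k"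
    using horn_fill[OF X, of "Suc n" j "j + 3" x'] pf
    by (auto simp: partial_filler_def numeral_3_eq_3)
  have "pull X 3 (Suc (Suc (Suc n))) ((+) j) H
      = pull X 3 (Suc (Suc n)) (\<lambda>i. unskip k (j + i)) (face X (Suc (Suc (Suc n))) k H)"
    unfolding face_eq_pull using k H \<open>j < Suc n\<close>
    by (subst pull_pull) (auto simp: mono_skip mono_def skip_def unskip_def intro!: pull_cong)
  also have "\<dots> = w"
    using pf k unfolding faces[OF k(1)] partial_filler_def by auto
  finally have "pull X 3 (Suc (Suc (Suc n))) ((+) j) H = w" .
  moreover have "face X (Suc (Suc (Suc n))) i H = x i" if "i \<in> S" for i
  proof -
    have "i \<in> {..n + 3} - {j, j + 3}"
      using Suc.prems(4) that by (auto simp: partial_filler_def)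
    then show ?thesis
      using faces x' that by simp
  qed
  ultimately have "fills X w (Suc n) j S x H"
    using H by (simp add: fills_def)
  then show ?case ..
qed

section \<open>Simplices of \<open>J\<close> and the theorem\<close>

lemma act_J:
  assumes "monotone_map m n f" "length v = Suc n"
  shows "act J n f (J_simplex v) = J_simplex (map ((!) v) f)"
proof -
  have "length f = Suc m" using assms by (simp add: monotone_map_def)
  then show ?thesis
    using assms monotone_map_nth_le[OF assms(1)] monotone_map_nth_mono[OF assms(1)]
    by (auto simp: J_def nerve_def J_simplex_def arrows_def fun_eq_iff restrict_def)
qed


theorem lemma6p1:
  fixes X :: "'a sset"
    and n j :: nat
    and h :: 'a
    and a :: "nat \<Rightarrow> (nat \<Rightarrow> nat) \<times> (nat \<times> nat \<Rightarrow> nat \<times> nat) \<Rightarrow> 'a"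
  assumes "quasi_2_Segal X"
    and "n \<ge> 2"
    and "j < n"
    and "h \<in> cells X n"
    and "simplicial_map J X a"
    and "spanned_face X n {j, j + 1} h = a 1 (J_simplex [0, 1])"
  shows "(\<exists>H\<in>cells X (n + 2).
            spanned_face X (n + 2) {j, j + 1, j + 2, j + 3} H = a 3 (J_simplex [0, 1, 0, 1]) \<and>
            face X (n + 2) (j + 1) H = degeneracy X n j h \<and>
            face X (n + 2) (j + 2) H = degeneracy X n (j + 1) h) \<and>
         (\<forall>S x.
            S \<subseteq> {..<j} \<union> {j + 4..n + 2} \<longrightarrow>
            (\<forall>k\<in>S. x k \<in> cells X (n + 1)) \<longrightarrow>
            x (j + 1) = degeneracy X n j h \<longrightarrow>
            x (j + 2) = degeneracy X n (j + 1) h \<longrightarrow>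
            (\<forall>k\<in>S \<union> {j + 1, j + 2}. \<forall>l\<in>S \<union> {j + 1, j + 2}. k < l \<longrightarrow>
               face X (n + 1) k (x l) = face X (n + 1) (l - 1) (x k)) \<longrightarrow>
            (\<forall>k\<in>S. spanned_face X (n + 1) (skip k -` {j, j + 1, j + 2, j + 3}) (x k)
               = a 3 (J_simplex [0, 1, 0, 1])) \<longrightarrow>
            (\<exists>H\<in>cells X (n + 2).
               spanned_face X (n + 2) {j, j + 1, j + 2, j + 3} H = a 3 (J_simplex [0, 1, 0, 1]) \<and>
               face X (n + 2) (j + 1) H = degeneracy X n j h \<and>
               face X (n + 2) (j + 2) H = degeneracy X n (j + 1) h \<and>
               (\<forall>k\<in>S. face X (n + 2) k H = x k)))"
proof -
  interpret simplicial_set X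
    using assms(1) by (simp add: quasi_2_Segal_def)
  define w where "w = a 3 (J_simplex [0, 1, 0, 1])"
  define e where "e = a 1 (J_simplex [0, 1])"
  have a_closed: "a m (J_simplex v) \<in> cells X m" if "length v = Suc m" "set v \<subseteq> {0, 1}" for m v
    using assms(5) that unfolding simplicial_map_def cells_J by blast
  have a_act: "act X m f (a m (J_simplex v)) = a l (J_simplex (map ((!) v) f))"
    if "length v = Suc m" "set v \<subseteq> {0, 1}" "monotone_map l m f" for l m f v
  proof -
    have "J_simplex v \<in> cells J m"
      using that unfolding cells_J by blast
    then show ?thesis
      using assms(5) that(3) act_J[OF that(3,1)] unfolding simplicial_map_def by metis
  qed
  have w: "w \<in> cells X 3" and e: "e \<in> cells X 1"
    unfolding w_def e_def by (auto intro: a_closed)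
  \<comment> \<open>Omitting vertex 1 from \<open>0 -> 1 -> 0 -> 1\<close> leaves the degenerate
    \<open>0 -> 0 -> 1\<close>; omitting vertex 2 leaves \<open>0 -> 1 -> 1\<close>.\<close>
  have w1: "face X 3 1 w = degeneracy X 1 0 e"
    unfolding face_def degeneracy_def w_def e_def
    by (subst (1 2) a_act[of _ _ 2]) (auto simp: monotone_map_def skip_def upt_rec)
  have w2: "face X 3 2 w = degeneracy X 1 1 e"
    unfolding face_def degeneracy_def w_def e_def
    by (subst (1 2) a_act[of _ _ 2]) (auto simp: monotone_map_def skip_def upt_rec)
  have list: "sorted_list_of_set {i, i + 1, i + 2, i + 3} = map ((+) i) [0..<Suc 3]" for i :: nat
    by (intro sorted_list_of_set.sorted_key_list_of_set_unique[THEN iffD1]) (auto simp: upt_rec)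
  have "sorted_list_of_set {j, j + 1} = map ((+) j) [0..<Suc 1]"
    by (simp add: sorted_list_of_set_insert_remove)
  then have edge: "pull X 1 n ((+) j) h = e"
    using assms(6) by (simp add: spanned_face_def pull_def e_def)
  \<comment> \<open>The version with prescribed faces; the first half of the theorem is its case of
    empty \<open>S\<close>.\<close>
  have fill: "\<exists>H\<in>cells X (n + 2).
      spanned_face X (n + 2) {j, j + 1, j + 2, j + 3} H = w \<and>
      face X (n + 2) (j + 1) H = degeneracy X n j h \<and>
      face X (n + 2) (j + 2) H = degeneracy X n (j + 1) h \<and>
      (\<forall>k\<in>S. face X (n + 2) k H = x k)"
    if S: "S \<subseteq> {..<j} \<union> {j + 4..n + 2}"
      and x: "\<forall>k\<in>S. x k \<in> cells X (n + 1)"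
        "x (j + 1) = degeneracy X n j h" "x (j + 2) = degeneracy X n (j + 1) h"
      and comp: "\<forall>k\<in>S \<union> {j + 1, j + 2}. \<forall>l\<in>S \<union> {j + 1, j + 2}. k < l \<longrightarrow>
        face X (n + 1) k (x l) = face X (n + 1) (l - 1) (x k)"
      and xw: "\<forall>k\<in>S. spanned_face X (n + 1) (skip k -` {j, j + 1, j + 2, j + 3}) (x k) = w"
    for S x
  proof -
    let ?S = "S \<union> {j + 1, j + 2}"
    have "degeneracy X n i h \<in> cells X (Suc n)" if "i \<le> n" for i
      unfolding degeneracy_eq_pull using that assms(4)
      by (intro pull_closed mono_unskip) (auto simp: unskip_def)
    then have "x k \<in> cells X (Suc n)" if "k \<in> ?S" for k
      using that x assms(3) by auto
    moreover have "face X (Suc n) (unskip l k) (x l) = face X (Suc n) (unskip k l) (x k)"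
      if "k \<in> ?S" "l \<in> ?S" "k \<noteq> l" for k l
    proof (cases "k < l")
      case True
      then show ?thesis
        using comp[rule_format, OF that(1,2)] by (simp add: unskip_def)
    next
      case False
      then show ?thesis
        using comp[rule_format, OF that(2,1)] that(3) by (simp add: unskip_def)
    qed
    ultimately have "compatible X (Suc n) ?S x"
      unfolding compatible_def by blast
    moreover have "pull X 3 (Suc n) (\<lambda>i. unskip k (j + i)) (x k) = w" if "k \<in> S" for k
    proof -
      have k: "k < j \<or> j + 3 < k" using S that by auto
      \<comment> \<open>As \<open>k\<close> is outside the block, the preimage is again a block of
        four consecutive vertices, starting at \<open>unskip k j\<close>.\<close>
      then have "skip k -` {j, j + 1, j + 2, j + 3}
          = {unskip k j, unskip k j + 1, unskip k j + 2, unskip k j + 3}"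
        by (auto simp: skip_def unskip_def split: if_splits)
      then have "pull X 3 (Suc n) ((+) (unskip k j)) (x k) = w"
        using xw[rule_format, OF that] by (simp only: spanned_face_def list pull_def Suc_eq_plus1)
      moreover have "pull X 3 (Suc n) (\<lambda>i. unskip k (j + i)) (x k)
          = pull X 3 (Suc n) ((+) (unskip k j)) (x k)"
        using k by (intro pull_cong) (auto simp: unskip_def)
      ultimately show ?thesis by simp
    qed
    moreover have "?S \<subseteq> {..n + 2} - {j, j + 3}"
      using S assms(3) by auto
    ultimately have "partial_filler X w n j h ?S x"
      unfolding partial_filler_def using x by auto
    then obtain H where "fills X w n j ?S x H"
      using partial_filler_fill[OF assms(1) w e w1 w2 _ assms(3,4) edge] assms(2) by auto
    then show ?thesis
      using x unfolding fills_def spanned_face_def list pull_def by auto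
  qed
  \<comment> \<open>A family taking the required values at \<open>j + 1\<close> and
    \<open>j + 2\<close>. The one compatibility to check holds because both faces equal
    \<open>h\<close>.\<close>
  define x where "x i = degeneracy X n (i - 1) h" for i
  have "face X (n + 1) (j + 1) (x (j + 2)) = face X (n + 1) (j + 1) (x (j + 1))"
    using assms(3,4) unfolding x_def Suc_eq_plus1[symmetric] face_eq_pull degeneracy_eq_pull
    by (subst (1 2) pull_pull)
      (auto simp: mono_skip mono_unskip skip_def unskip_def intro!: pull_cong)
  then have "\<exists>H\<in>cells X (n + 2).
      spanned_face X (n + 2) {j, j + 1, j + 2, j + 3} H = w \<and>
      face X (n + 2) (j + 1) H = degeneracy X n j h \<and>
      face X (n + 2) (j + 2) H = degeneracy X n (j + 1) h"
    using fill[of "{}" x] by (auto simp: x_def)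
  then show ?thesis
    using fill unfolding w_def by blast
qed

end
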